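(* Let $n\ge 1$, $N=2^n$, and let $\boldsymbol\pi_n$ be uniformly distributed on the group $B_{n,s}$ of simple butterfly permutations. For $k\ge 0$ let $W_k(\boldsymbol\pi_n)$ be the number of nodes of $\mathcal T(\boldsymbol\pi_n)$ at depth $k$, and let $W(\boldsymbol\pi_n)=\max_k W_k(\boldsymbol\pi_n)$ be the maximal width. Then $$W(\boldsymbol\pi_n)=W_{\min(\mathrm{LIS}(\boldsymbol\pi_n),\mathrm{LDS}(\boldsymbol\pi_n))-1}(\boldsymbol\pi_n)=\min(\mathrm{LIS}(\boldsymbol\pi_n),\mathrm{LDS}(\boldsymbol\pi_n)),$$ and $W(\boldsymbol\pi_n)$ has the same distribution as $2^{\min(X_n,\,n-X_n)}$, where $X_n\sim\mathrm{Binomial}(n,1/2)$. Moreover, with $M(\boldsymbol\pi_n)=\max(\mathrm{LIS}(\boldsymbol\pi_n),\mathrm{LDS}(\boldsymbol\pi_n))$ the length of the longest monotone subsequence, $W(\boldsymbol\pi_n)\cdot M(\boldsymbol\pi_n)=N$.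
   Context: For a permutation $\pi\in S_k$ written in one-line notation, $\mathcal T(\pi)$ is the binary search tree obtained by inserting the keys $\pi(1),\pi(2),\dots,\pi(k)$ in this order into the initially empty tree (smaller keys go left, larger keys go right). The depth of a node is the number of edges on the path from the root to it. $\mathrm{LIS}(\pi)$ and $\mathrm{LDS}(\pi)$ denote the lengths (numbers of terms) of the longest increasing and longest decreasing subsequences of $\pi(1)\cdots\pi(k)$. For $\pi\in S_k$ let $P_\pi$ be the permutation matrix with $P_\pi e_i=e_{\pi(i)}$. For permutations $\rho,\pi$, the permutation $\rho\otimes\pi$ is the one with matrix $P_\rho\otimes P_\pi$ (Kronecker product, i.e. each entry $(P_\rho)_{ij}$ is replaced by the block $(P_\rho)_{ij}P_\pi$). The group of simple butterfly permutations is $B_{n,s}=S_2^{\otimes n}=\{\pi_n\otimes\cdots\otimes\pi_1:\pi_j\in S_2\}\subset S_{2^n}$. *)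

theory Defs
  imports
    "HOL-Probability.Probability"
    "HOL-Combinatorics.Permutations"
    "HOL-Library.Sublist"
    "HOL-Library.Tree"
    "Jordan_Normal_Form.Matrix"
begin

section \<open>Permutations and their Kronecker products\<close>

text \<open>
  A permutation in \<open>S\<^sub>k\<close> is a function \<open>\<pi>\<close> with \<open>\<pi> permutes {1..k}\<close> (hence the identity
  outside \<open>{1..k}\<close>). Matrices are indexed from 0, so the entry of the mathematical position
  \<open>(i + 1, j + 1)\<close> is stored at \<open>(i, j)\<close>.
\<close>

definition perm_mat :: "nat \<Rightarrow> (nat \<Rightarrow> nat) \<Rightarrow> int mat" where
  "perm_mat k \<pi> = mat k k (\<lambda>(i, j). if \<pi> (Suc j) = Suc i then 1 else 0)"

definition kronecker :: "'a::times mat \<Rightarrow> 'a mat \<Rightarrow> 'a mat" where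
  "kronecker A B =
     mat (dim_row A * dim_row B) (dim_col A * dim_col B)
       (\<lambda>(i, j). A $$ (i div dim_row B, j div dim_col B) * B $$ (i mod dim_row B, j mod dim_col B))"

text \<open>\<open>kron_perm m \<rho> k \<pi>\<close> is \<open>\<rho> \<otimes> \<pi>\<close> for \<open>\<rho> \<in> S\<^sub>m\<close> and \<open>\<pi> \<in> S\<^sub>k\<close>; well-defined by \<open>kron_perm_unique\<close> below.\<close>

definition kron_perm :: "nat \<Rightarrow> (nat \<Rightarrow> nat) \<Rightarrow> nat \<Rightarrow> (nat \<Rightarrow> nat) \<Rightarrow> nat \<Rightarrow> nat" where
  "kron_perm m \<rho> k \<pi> =
     (THE \<sigma>. \<sigma> permutes {1..m * k} \<and>
        perm_mat (m * k) \<sigma> = kronecker (perm_mat m \<rho>) (perm_mat k \<pi>))"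

text \<open>\<open>kron_seq n p\<close> is \<open>p\<^sub>n \<otimes> \<dots> \<otimes> p\<^sub>1\<close>; the empty product is the identity in \<open>S\<^sub>1\<close>.\<close>

primrec kron_seq :: "nat \<Rightarrow> (nat \<Rightarrow> nat \<Rightarrow> nat) \<Rightarrow> nat \<Rightarrow> nat" where
  "kron_seq 0 p = id"
| "kron_seq (Suc n) p = kron_perm 2 (p (Suc n)) (2 ^ n) (kron_seq n p)"

definition simple_butterfly :: "nat \<Rightarrow> (nat \<Rightarrow> nat) set" where
  "simple_butterfly n = {kron_seq n p | p. \<forall>j\<in>{1..n}. p j permutes {1..2}}"


section \<open>Binary search trees and their widths\<close>

definition one_line :: "nat \<Rightarrow> (nat \<Rightarrow> nat) \<Rightarrow> nat list" where
  "one_line k \<pi> = map \<pi> [1..<Suc k]"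

fun bst_insert :: "'a::linorder \<Rightarrow> 'a tree \<Rightarrow> 'a tree" where
  "bst_insert x \<langle>\<rangle> = \<langle>\<langle>\<rangle>, x, \<langle>\<rangle>\<rangle>"
| "bst_insert x \<langle>l, a, r\<rangle> =
     (if x < a then \<langle>bst_insert x l, a, r\<rangle>
      else if a < x then \<langle>l, a, bst_insert x r\<rangle>
      else \<langle>l, a, r\<rangle>)"

definition perm_bst :: "nat \<Rightarrow> (nat \<Rightarrow> nat) \<Rightarrow> nat tree" where
  "perm_bst k \<pi> = fold bst_insert (one_line k \<pi>) \<langle>\<rangle>"

text \<open>
  Nodes are identified with the edge sequences leading to them from the root
  (\<open>False\<close> for left, \<open>True\<close> for right), so the depth of a node is the length of its address.
\<close>

primrec nodes :: "'a tree \<Rightarrow> bool list set" where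
  "nodes \<langle>\<rangle> = {}"
| "nodes \<langle>l, a, r\<rangle> = {[]} \<union> (#) False ` nodes l \<union> (#) True ` nodes r"

definition level_width :: "nat \<Rightarrow> 'a tree \<Rightarrow> nat" where
  "level_width d t = card {v \<in> nodes t. length v = d}"

definition max_width :: "'a tree \<Rightarrow> nat" where
  "max_width t = (MAX d. level_width d t)"


section \<open>Longest monotone subsequences\<close>

definition LIS :: "nat \<Rightarrow> (nat \<Rightarrow> nat) \<Rightarrow> nat" where
  "LIS k \<pi> = Max {length ys | ys. subseq ys (one_line k \<pi>) \<and> sorted_wrt (<) ys}"

definition LDS :: "nat \<Rightarrow> (nat \<Rightarrow> nat) \<Rightarrow> nat" where
  "LDS k \<pi> = Max {length ys | ys. subseq ys (one_line k \<pi>) \<and> sorted_wrt (>) ys}"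


section \<open>Well-definedness\<close>

lemma perm_mat_inj:
  assumes "\<sigma> permutes {1..n}" "\<tau> permutes {1..n}" "perm_mat n \<sigma> = perm_mat n \<tau>"
  shows "\<sigma> = \<tau>"
proof
  fix x
  show "\<sigma> x = \<tau> x"
  proof (cases "x \<in> {1..n}")
    case True
    then obtain j where j: "x = Suc j" "j < n" by (cases x) auto
    from permutes_in_image[OF assms(1), of x] True have "\<sigma> x \<in> {1..n}" by simp
    then obtain i where i: "\<sigma> x = Suc i" "i < n" by (cases "\<sigma> x") auto
    have "perm_mat n \<sigma> $$ (i, j) = perm_mat n \<tau> $$ (i, j)" using assms(3) by simp
    with i j show ?thesis by (simp add: perm_mat_def split: if_splits)
  next
    case False
    with assms(1,2) show ?thesis by (simp add: permutes_not_in)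
  qed
qed

definition kron_fun :: "nat \<Rightarrow> (nat \<Rightarrow> nat) \<Rightarrow> nat \<Rightarrow> (nat \<Rightarrow> nat) \<Rightarrow> nat \<Rightarrow> nat" where
  "kron_fun m \<rho> k \<pi> x =
     (if x \<in> {1..m * k}
      then k * (\<rho> (Suc ((x - 1) div k)) - 1) + \<pi> (Suc ((x - 1) mod k)) else x)"

lemma kron_fun_Suc:
  assumes \<rho>: "\<rho> permutes {1..m}" and \<pi>: "\<pi> permutes {1..k}" and j: "j < m * k"
  obtains a b where "\<rho> (Suc (j div k)) = Suc a" "a < m" "\<pi> (Suc (j mod k)) = Suc b" "b < k"
    "kron_fun m \<rho> k \<pi> (Suc j) = Suc (k * a + b)" "k * a + b < m * k"
proof -
  have k: "k > 0" using j by (cases k) auto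
  have "Suc (j div k) \<in> {1..m}" using j k by (simp add: Suc_le_eq less_mult_imp_div_less)
  then have "\<rho> (Suc (j div k)) \<in> {1..m}" using permutes_in_image[OF \<rho>] by blast
  then obtain a where a: "\<rho> (Suc (j div k)) = Suc a" "a < m"
    by (cases "\<rho> (Suc (j div k))") auto
  have "Suc (j mod k) \<in> {1..k}" using k by (simp add: Suc_le_eq)
  then have "\<pi> (Suc (j mod k)) \<in> {1..k}" using permutes_in_image[OF \<pi>] by blast
  then obtain b where b: "\<pi> (Suc (j mod k)) = Suc b" "b < k"
    by (cases "\<pi> (Suc (j mod k))") auto
  have "k * a + b < k * Suc a" using b by simp
  also have "\<dots> \<le> k * m" using a by (intro mult_le_mono2) simp
  finally have "k * a + b < m * k" by (simp add: mult.commute)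
  moreover have "kron_fun m \<rho> k \<pi> (Suc j) = Suc (k * a + b)"
    using j a b by (simp add: kron_fun_def Suc_le_eq)
  ultimately show thesis using that a b by blast
qed

lemma kron_fun_permutes:
  assumes \<rho>: "\<rho> permutes {1..m}" and \<pi>: "\<pi> permutes {1..k}"
  shows "kron_fun m \<rho> k \<pi> permutes {1..m * k}"
proof (rule bij_imp_permutes)
  let ?f = "kron_fun m \<rho> k \<pi>"
  have "inj_on ?f {1..m * k}"
  proof (rule inj_onI)
    fix x y assume xy: "x \<in> {1..m * k}" "y \<in> {1..m * k}" "?f x = ?f y"
    obtain i j where ij: "x = Suc i" "i < m * k" "y = Suc j" "j < m * k"
      using xy by (cases x; cases y) auto
    obtain a b where ab: "\<rho> (Suc (i div k)) = Suc a" "\<pi> (Suc (i mod k)) = Suc b" "b < k"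
        "?f (Suc i) = Suc (k * a + b)"
      using kron_fun_Suc[OF \<rho> \<pi> ij(2)] by metis
    obtain c d where cd: "\<rho> (Suc (j div k)) = Suc c" "\<pi> (Suc (j mod k)) = Suc d" "d < k"
        "?f (Suc j) = Suc (k * c + d)"
      using kron_fun_Suc[OF \<rho> \<pi> ij(4)] by metis
    have eq: "k * a + b = k * c + d" using xy(3) ij ab cd by simp
    have "(k * a + b) div k = (k * c + d) div k" "(k * a + b) mod k = (k * c + d) mod k"
      using eq by simp_all
    then have "a = c" "b = d" using ab(3) cd(3) by simp_all
    then have "i div k = j div k" "i mod k = j mod k"
      using ab cd permutes_inj[OF \<rho>] permutes_inj[OF \<pi>] by (metis injD nat.inject)+
    then have "i = j" by (metis div_mult_mod_eq)
    then show "x = y" using ij by simp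
  qed
  moreover have "?f ` {1..m * k} \<subseteq> {1..m * k}"
  proof
    fix y assume "y \<in> ?f ` {1..m * k}"
    then obtain x where x: "x \<in> {1..m * k}" "y = ?f x" by blast
    then obtain i where i: "x = Suc i" "i < m * k" by (cases x) auto
    from kron_fun_Suc[OF \<rho> \<pi> i(2)] x(2) i(1) show "y \<in> {1..m * k}"
      by (metis Suc_leI atLeastAtMost_iff le_add1 plus_1_eq_Suc)
  qed
  ultimately show "bij_betw ?f {1..m * k} {1..m * k}"
    by (simp add: bij_betw_def endo_inj_surj)
qed (auto simp: kron_fun_def)

lemma perm_mat_kron_fun:
  assumes \<rho>: "\<rho> permutes {1..m}" and \<pi>: "\<pi> permutes {1..k}"
  shows "perm_mat (m * k) (kron_fun m \<rho> k \<pi>) = kronecker (perm_mat m \<rho>) (perm_mat k \<pi>)"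
proof (rule eq_matI)
  fix i j
  assume "i < dim_row (kronecker (perm_mat m \<rho>) (perm_mat k \<pi>))"
    and "j < dim_col (kronecker (perm_mat m \<rho>) (perm_mat k \<pi>))"
  then have i: "i < m * k" and j: "j < m * k"
    by (simp_all add: kronecker_def perm_mat_def)
  have k: "k > 0" using j by (cases k) auto
  obtain a b where ab: "\<rho> (Suc (j div k)) = Suc a" "\<pi> (Suc (j mod k)) = Suc b" "b < k"
      "kron_fun m \<rho> k \<pi> (Suc j) = Suc (k * a + b)"
    using kron_fun_Suc[OF \<rho> \<pi> j] by metis
  have "k * a + b = i \<longleftrightarrow> a = i div k \<and> b = i mod k"
    using ab(3) by auto
  then show "perm_mat (m * k) (kron_fun m \<rho> k \<pi>) $$ (i, j) =
      kronecker (perm_mat m \<rho>) (perm_mat k \<pi>) $$ (i, j)"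
    using i j k ab by (simp add: kronecker_def perm_mat_def less_mult_imp_div_less)
qed (simp_all add: kronecker_def perm_mat_def)

lemma kron_perm_unique:
  assumes "\<rho> permutes {1..m}" "\<pi> permutes {1..k}"
  shows "\<exists>!\<sigma>. \<sigma> permutes {1..m * k} \<and>
           perm_mat (m * k) \<sigma> = kronecker (perm_mat m \<rho>) (perm_mat k \<pi>)"
  using kron_fun_permutes[OF assms] perm_mat_kron_fun[OF assms] perm_mat_inj by metis

lemma kron_perm_eq:
  assumes "\<rho> permutes {1..m}" "\<pi> permutes {1..k}"
  shows "kron_perm m \<rho> k \<pi> = kron_fun m \<rho> k \<pi>"
  unfolding kron_perm_def
  using kron_fun_permutes[OF assms] perm_mat_kron_fun[OF assms] kron_perm_unique[OF assms]
  by (intro the1_equality) auto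

lemma kron_seq_permutes:
  assumes "\<forall>j\<in>{1..n}. p j permutes {1..2}"
  shows "kron_seq n p permutes {1..2 ^ n}"
  using assms
proof (induction n)
  case 0
  show ?case by (simp add: id_def)
next
  case (Suc n)
  then have "p (Suc n) permutes {1..2}" "kron_seq n p permutes {1..2 ^ n}" by simp_all
  from kron_fun_permutes[OF this] kron_perm_eq[OF this] show ?case by simp
qed

lemma simple_butterfly_finite: "finite (simple_butterfly n)"
proof (rule finite_subset)
  show "simple_butterfly n \<subseteq> {\<sigma>. \<sigma> permutes {1..2 ^ n}}"
    using kron_seq_permutes by (auto simp: simple_butterfly_def)
qed (rule finite_permutations, simp)

lemma simple_butterfly_nonempty: "simple_butterfly n \<noteq> {}"
proof -
  have "kron_seq n (\<lambda>_. id) \<in> simple_butterfly n"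
    unfolding simple_butterfly_def using permutes_id by blast
  then show ?thesis by blast
qed

lemma finite_nodes: "finite (nodes t)"
  by (induction t) simp_all

lemma finite_level_widths: "finite (range (\<lambda>d. level_width d t))"
proof (rule finite_subset)
  show "range (\<lambda>d. level_width d t) \<subseteq> {..card (nodes t)}"
    by (auto simp: level_width_def intro!: card_mono finite_nodes)
qed simp

lemma finite_subseq_lengths: "finite {length ys | ys. subseq ys xs \<and> P ys}"
proof (rule finite_subset)
  show "{length ys | ys. subseq ys xs \<and> P ys} \<subseteq> {..length xs}"
    by (auto dest: list_emb_length)
qed simp

end

theory Submission
  imports Defs
begin

text \<open>Left factors \<open>id\<close> and \<open>(1 2)\<close> turn the one-line word \<open>w\<close> into \<open>w (w + K)\<close> and \<open>(w + K) w\<close>,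
  so LIS respectively LDS doubles: with \<open>a\<close> identity factors, they are \<open>A = 2\<^sup>a\<close> and
  \<open>B = 2\<^sup>n\<^sup>-\<^sup>a\<close>. On trees, a second copy is grafted at the end of the right (left) spine, whose
  number of nodes is also \<open>A\<close> (\<open>B\<close>). Hence the generating function of the level widths is
  multiplied by \<open>1 + z\<^sup>A\<close> (\<open>1 + z\<^sup>B\<close>) and telescopes to
  \<open>(1 + \<dots> + z\<^sup>A\<^sup>-\<^sup>1) (1 + \<dots> + z\<^sup>B\<^sup>-\<^sup>1)\<close>: level \<open>k\<close> has as many nodes as
  the antidiagonal \<open>i + j = k\<close> has points in an \<open>A \<times> B\<close> grid, so the maximum \<open>min A B\<close> is first
  reached at \<open>k = min A B - 1\<close>.\<close>

section \<open>Longest monotone subsequences of concatenations\<close>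

text \<open>One notion for both orders: \<open>R\<close> is \<open><\<close> for LIS and
  \<open>>\<close> for LDS, so each concatenation lemma serves both.\<close>

definition longest :: "('a \<Rightarrow> 'a \<Rightarrow> bool) \<Rightarrow> 'a list \<Rightarrow> nat" where
  "longest R xs = Max {length ys | ys. subseq ys xs \<and> sorted_wrt R ys}"

lemma longest_ge: "subseq ys xs \<Longrightarrow> sorted_wrt R ys \<Longrightarrow> length ys \<le> longest R xs"
  unfolding longest_def by (rule Max_ge[OF finite_subseq_lengths]) blast

lemma longest_witness:
  obtains ys where "subseq ys xs" "sorted_wrt R ys" "length ys = longest R xs"
proof -
  have "longest R xs \<in> {length ys | ys. subseq ys xs \<and> sorted_wrt R ys}"
    unfolding longest_def
    by (rule Max_in[OF finite_subseq_lengths]) (use sorted_wrt.simps(1) in blast)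
  then show ?thesis using that by auto
qed

lemma longest_le:
  assumes "\<And>ys. subseq ys xs \<Longrightarrow> sorted_wrt R ys \<Longrightarrow> length ys \<le> m"
  shows "longest R xs \<le> m"
  by (metis assms longest_witness)

text \<open>A chain of the concatenation splits into a chain of each half; conversely, comparability
  lets two longest chains be joined.\<close>

lemma longest_append_comparable:
  assumes "\<forall>x\<in>set xs. \<forall>y\<in>set ys. R x y"
  shows "longest R (xs @ ys) = longest R xs + longest R ys"
proof (rule antisym)
  show "longest R (xs @ ys) \<le> longest R xs + longest R ys"
  proof (rule longest_le)
    fix zs assume zs: "subseq zs (xs @ ys)" "sorted_wrt R zs"
    from zs(1) obtain us vs where "zs = us @ vs" "subseq us xs" "subseq vs ys"
      by (rule subseq_appendE)
    with zs(2) show "length zs \<le> longest R xs + longest R ys"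
      by (auto simp: sorted_wrt_append intro!: add_mono longest_ge)
  qed
next
  obtain us where us: "subseq us xs" "sorted_wrt R us" "length us = longest R xs"
    by (rule longest_witness)
  obtain vs where vs: "subseq vs ys" "sorted_wrt R vs" "length vs = longest R ys"
    by (rule longest_witness)
  have "set us \<subseteq> set xs" "set vs \<subseteq> set ys"
    using us vs by (auto dest: list_emb_set)
  then have "sorted_wrt R (us @ vs)"
    using us vs assms by (auto simp: sorted_wrt_append)
  moreover have "subseq (us @ vs) (xs @ ys)"
    using us vs by (intro list_emb_append_mono)
  ultimately show "longest R xs + longest R ys \<le> longest R (xs @ ys)"
    using longest_ge us vs by (metis length_append)
qed

text \<open>No chain takes terms from both halves, so each chain lies in one of them.\<close>

lemma longest_append_incomparable:
  assumes "\<forall>x\<in>set xs. \<forall>y\<in>set ys. \<not> R x y"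
  shows "longest R (xs @ ys) = max (longest R xs) (longest R ys)"
proof (rule antisym)
  show "longest R (xs @ ys) \<le> max (longest R xs) (longest R ys)"
  proof (rule longest_le)
    fix zs assume zs: "subseq zs (xs @ ys)" "sorted_wrt R zs"
    from zs(1) obtain us vs where uv: "zs = us @ vs" "subseq us xs" "subseq vs ys"
      by (rule subseq_appendE)
    have "set us \<subseteq> set xs" "set vs \<subseteq> set ys"
      using uv by (auto dest: list_emb_set)
    then have "us = [] \<or> vs = []"
      using uv(1) zs(2) assms by (cases us; cases vs) (auto simp: sorted_wrt_append)
    with uv zs(2) show "length zs \<le> max (longest R xs) (longest R ys)"
      by (auto simp: le_max_iff_disj intro: longest_ge)
  qed
next
  have "longest R xs \<le> longest R (xs @ ys)" "longest R ys \<le> longest R (xs @ ys)"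
    by (rule longest_le, rule longest_ge, auto)+
  then show "max (longest R xs) (longest R ys) \<le> longest R (xs @ ys)" by simp
qed

lemma longest_map:
  assumes "\<And>x y. R (f x) (f y) \<longleftrightarrow> R x y"
  shows "longest R (map f xs) = longest R xs"
proof (rule antisym)
  show "longest R (map f xs) \<le> longest R xs"
  proof (rule longest_le)
    fix ys assume ys: "subseq ys (map f xs)" "sorted_wrt R ys"
    \<comment> \<open>A subsequence is a selection of positions (\<open>nths\<close>), and selecting
      positions commutes with \<open>map\<close>.\<close>
    then obtain zs where "subseq zs xs" "ys = map f zs"
      by (metis subseq_map subseq_conv_nths nths_map)
    with ys(2) show "length ys \<le> longest R xs"
      using assms by (auto simp: sorted_wrt_map intro: longest_ge)
  qed
next
  obtain us where us: "subseq us xs" "sorted_wrt R us" "length us = longest R xs"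
    by (rule longest_witness)
  then have "length (map f us) \<le> longest R (map f xs)"
    using assms by (intro longest_ge subseq_map) (simp_all add: sorted_wrt_map)
  with us show "longest R xs \<le> longest R (map f xs)" by simp
qed


section \<open>Grafting binary search trees\<close>

text \<open>Puts \<open>u\<close> in place of the empty tree at the end of the spine in direction
  \<open>d\<close>; as in \<open>nodes\<close>, \<open>True\<close> means right.\<close>

primrec graft :: "bool \<Rightarrow> 'a tree \<Rightarrow> 'a tree \<Rightarrow> 'a tree" where
  "graft d \<langle>\<rangle> u = u"
| "graft d \<langle>l, a, r\<rangle> u = (if d then \<langle>l, a, graft d r u\<rangle> else \<langle>graft d l u, a, r\<rangle>)"

text \<open>Counts nodes rather than edges, which makes it the depth at which the root of a grafted
  tree lands.\<close>

primrec spine :: "bool \<Rightarrow> 'a tree \<Rightarrow> nat" where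
  "spine d \<langle>\<rangle> = 0"
| "spine d \<langle>l, a, r\<rangle> = (if d then Suc (spine d r) else Suc (spine d l))"

abbreviation bst_of :: "'a::linorder list \<Rightarrow> 'a tree" where
  "bst_of xs \<equiv> fold bst_insert xs \<langle>\<rangle>"

lemma set_tree_bst_insert: "set_tree (bst_insert x t) = insert x (set_tree t)"
  by (induction t) auto

lemma set_tree_fold_bst_insert: "set_tree (fold bst_insert xs t) = set xs \<union> set_tree t"
  by (induction xs arbitrary: t) (auto simp: set_tree_bst_insert)

text \<open>A key beyond all keys of \<open>t\<close> on side \<open>d\<close> turns in direction
  \<open>d\<close> at every node it meets in \<open>t\<close>, and so reaches
  \<open>u\<close>.\<close>

lemma bst_insert_graft:
  assumes "\<forall>y\<in>set_tree t. if d then y < x else x < y"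
  shows "bst_insert x (graft d t u) = graft d t (bst_insert x u)"
  using assms by (induction t) (auto dest: order.asym)

lemma fold_bst_insert_graft:
  assumes "\<forall>y\<in>set_tree t. \<forall>x\<in>set xs. if d then y < x else x < y"
  shows "fold bst_insert xs (graft d t u) = graft d t (fold bst_insert xs u)"
  using assms
proof (induction xs arbitrary: u)
  case (Cons x xs)
  then have "bst_insert x (graft d t u) = graft d t (bst_insert x u)"
    by (intro bst_insert_graft) auto
  with Cons show ?case by simp
qed simp

lemma graft_Leaf: "graft d t \<langle>\<rangle> = t"
  by (induction t) auto

text \<open>Once \<open>xs\<close> is inserted, every key of \<open>ys\<close> runs to the end of
  the spine, so \<open>ys\<close> builds its own tree there, starting from a grafted empty
  tree.\<close>

lemma bst_of_append:
  assumes "\<forall>y\<in>set xs. \<forall>x\<in>set ys. if d then y < x else x < y"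
  shows "bst_of (xs @ ys) = graft d (bst_of xs) (bst_of ys)"
  using fold_bst_insert_graft[of "bst_of xs" ys d "\<langle>\<rangle>"] assms
  by (simp add: graft_Leaf set_tree_fold_bst_insert)

text \<open>Insertion only compares keys, which a strictly monotone map respects; hence shifting a
  word keeps the shape of its tree.\<close>

lemma bst_insert_map_tree:
  "strict_mono f \<Longrightarrow> bst_insert (f x) (map_tree f t) = map_tree f (bst_insert x t)"
  by (induction t) (auto simp: strict_mono_less)

lemma bst_of_map: "strict_mono f \<Longrightarrow> bst_of (map f xs) = map_tree f (bst_of xs)"
proof -
  assume f: "strict_mono f"
  have "fold bst_insert (map f xs) (map_tree f t) = map_tree f (fold bst_insert xs t)" for t
    by (induction xs arbitrary: t) (simp_all add: bst_insert_map_tree[OF f])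
  from this[of "\<langle>\<rangle>"] show ?thesis by simp
qed

section \<open>Level widths and spines under relabelling and grafting\<close>

lemma nodes_map_tree: "nodes (map_tree f t) = nodes t"
  by (induction t) simp_all

lemma level_width_map_tree: "level_width d (map_tree f t) = level_width d t"
  by (simp add: level_width_def nodes_map_tree)

lemma spine_map_tree: "spine d (map_tree f t) = spine d t"
  by (induction t) auto

lemma level_width_Leaf: "level_width k \<langle>\<rangle> = 0"
  by (simp add: level_width_def)

lemma level_width_Node_0: "level_width 0 \<langle>l, a, r\<rangle> = 1"
proof -
  have "{v \<in> nodes \<langle>l, a, r\<rangle>. length v = 0} = {[]}" by auto
  then show ?thesis by (simp add: level_width_def)
qed

lemma level_width_Node_Suc:
  "level_width (Suc k) \<langle>l, a, r\<rangle> = level_width k l + level_width k r"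
proof -
  have "{v \<in> nodes \<langle>l, a, r\<rangle>. length v = Suc k} =
      (#) False ` {v \<in> nodes l. length v = k} \<union> (#) True ` {v \<in> nodes r. length v = k}"
    by auto
  also have "card \<dots> = card ((#) False ` {v \<in> nodes l. length v = k}) +
      card ((#) True ` {v \<in> nodes r. length v = k})"
    by (intro card_Un_disjoint) (auto simp: finite_nodes)
  also have "\<dots> = level_width k l + level_width k r"
    by (simp add: level_width_def card_image)
  finally show ?thesis by (simp add: level_width_def)
qed

text \<open>Nodes of \<open>u\<close> sink by \<open>spine d t\<close>, those of \<open>t\<close>
  stay. If both trees have the same widths, this multiplies the generating function by 1 + z^s with
  s = \<open>spine d t\<close>.\<close>

lemma level_width_graft:
  "level_width k (graft d t u) =
     level_width k t + (if spine d t \<le> k then level_width (k - spine d t) u else 0)"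
proof (induction t arbitrary: k)
  case Leaf
  then show ?case by (simp add: level_width_Leaf)
next
  case (Node l a r)
  then show ?case
    by (cases k) (auto simp: level_width_Node_0 level_width_Node_Suc)
qed

lemma spine_graft: "spine d (graft d t u) = spine d t + spine d u"
  by (induction t) auto

text \<open>The graft alters only the subtree of the root on side \<open>d\<close>, which the
  opposite spine never enters. For empty \<open>t\<close> the graft is \<open>u\<close>
  itself.\<close>

lemma spine_graft_other: "t \<noteq> \<langle>\<rangle> \<Longrightarrow> spine (\<not> d) (graft d t u) = spine (\<not> d) t"
  by (induction t) auto


section \<open>Lattice points on antidiagonals\<close>

text \<open>Here \<open>i\<close> stands for the grid point (i, k - i); the guard
  \<open>i \<le> k\<close> excludes truncated differences.\<close>

definition antidiag :: "nat \<Rightarrow> nat \<Rightarrow> nat \<Rightarrow> nat" where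
  "antidiag A B k = card {i. i < A \<and> i \<le> k \<and> k - i < B}"

text \<open>The reflection i -> k - i exchanges the two coordinates and is its own inverse.\<close>

lemma antidiag_commute: "antidiag A B k = antidiag B A k"
  unfolding antidiag_def
  by (rule bij_betw_same_card[of "\<lambda>i. k - i"], rule bij_betw_byWitness[of _ "\<lambda>i. k - i"]) auto

text \<open>Cut the grid at column \<open>A\<close>: the remaining \<open>A'\<close> columns form a
  translated grid, met by its antidiagonal k - A. This is the recursion of
  \<open>level_width_graft\<close> for a spine of \<open>A\<close> nodes.\<close>

lemma antidiag_add:
  "antidiag (A + A') B k = antidiag A B k + (if A \<le> k then antidiag A' B (k - A) else 0)"
proof -
  let ?S = "{i. i < A \<and> i \<le> k \<and> k - i < B}"
  let ?T = "{i. A \<le> i \<and> i < A + A' \<and> i \<le> k \<and> k - i < B}"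
  have "{i. i < A + A' \<and> i \<le> k \<and> k - i < B} = ?S \<union> ?T" by auto
  then have "antidiag (A + A') B k = card (?S \<union> ?T)"
    by (simp only: antidiag_def)
  also have "\<dots> = antidiag A B k + card ?T"
    unfolding antidiag_def by (intro card_Un_disjoint) auto
  finally have split: "antidiag (A + A') B k = antidiag A B k + card ?T" .
  have "card ?T = (if A \<le> k then antidiag A' B (k - A) else 0)"
  proof (cases "A \<le> k")
    case True
    then obtain l where l: "k = A + l" using le_Suc_ex[of A k] by blast
    have "?T = (+) A ` {i. i < A' \<and> i \<le> l \<and> l - i < B}"
    proof (intro equalityI subsetI)
      fix i assume i: "i \<in> ?T"
      then obtain j where "i = A + j" using le_Suc_ex[of A i] by blast
      with i l show "i \<in> (+) A ` {i. i < A' \<and> i \<le> l \<and> l - i < B}" by simp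
    qed (use l in auto)
    then have "card ?T = card {i. i < A' \<and> i \<le> l \<and> l - i < B}"
      by (simp only: card_image inj_on_add)
    then show ?thesis using l by (simp add: antidiag_def)
  next
    case False
    then have "?T = {}" by auto
    then show ?thesis using False by simp
  qed
  with split show ?thesis by simp
qed

text \<open>An antidiagonal meets each column at most once, and by symmetry each row.\<close>

lemma antidiag_le: "antidiag A B k \<le> min A B"
proof -
  have "antidiag A B k \<le> A" for A B
    unfolding antidiag_def by (rule order_trans[OF card_mono[of "{..<A}"]]) auto
  then show ?thesis by (metis antidiag_commute min.boundedI)
qed

lemma antidiag_min:
  assumes "A > 0" "B > 0"
  shows "antidiag A B (min A B - 1) = min A B"
proof -
  have "{i. i < A \<and> i \<le> min A B - 1 \<and> min A B - 1 - i < B} = {..<min A B}"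
    using assms by auto
  then show ?thesis by (simp add: antidiag_def)
qed

lemma antidiag_1_1: "antidiag 1 1 k = (if k = 0 then 1 else 0)"
proof -
  have "{i. i < 1 \<and> i \<le> k \<and> k - i < (1::nat)} = (if k = 0 then {0} else {})" by auto
  then show ?thesis by (simp add: antidiag_def)
qed


section \<open>Simple butterfly permutations\<close>

text \<open>The invariant of the induction over the factors. The spines belong to it because they
  fix the depth of the next graft; positivity makes the tree nonempty.\<close>

definition butterfly_shape :: "nat \<Rightarrow> nat \<Rightarrow> nat list \<Rightarrow> bool" where
  "butterfly_shape A B w \<longleftrightarrow> A > 0 \<and> B > 0 \<and>
     longest (<) w = A \<and> longest (>) w = B \<and>
     spine True (bst_of w) = A \<and> spine False (bst_of w) = B \<and>
     (\<forall>k. level_width k (bst_of w) = antidiag A B k)"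

lemma butterfly_shape_singleton: "butterfly_shape 1 1 [x]"
proof -
  have "longest R [x] = 1" for R :: "nat \<Rightarrow> nat \<Rightarrow> bool"
  proof (rule antisym)
    show "longest R [x] \<le> 1" by (rule longest_le) (auto dest: list_emb_length)
    show "1 \<le> longest R [x]" using longest_ge[of "[x]" "[x]" R] by simp
  qed
  moreover have "level_width k (bst_of [x]) = antidiag 1 1 k" for k
    by (cases k) (simp_all only: antidiag_1_1, simp_all add: level_width_Node_0 level_width_Node_Suc level_width_Leaf)
  ultimately show ?thesis by (simp add: butterfly_shape_def)
qed

text \<open>Keys in {1..K} lie below all shifted keys. Chains in the order from first half to second
  add up, those in the reverse order stay in one half, and the later copy is grafted at the end of a
  spine.\<close>

lemma butterfly_shape_double:
  assumes "butterfly_shape A B w" and w: "set w \<subseteq> {1..K}"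
  shows "butterfly_shape (2 * A) B (w @ map ((+) K) w)"
    and "butterfly_shape A (2 * B) (map ((+) K) w @ w)"
proof -
  let ?w' = "map ((+) K) w"
  have mono: "strict_mono ((+) K)" by (simp add: strict_mono_def)
  have sh: "A > 0" "B > 0" "longest (<) w = A" "longest (>) w = B"
      "spine True (bst_of w) = A" "spine False (bst_of w) = B"
      "\<And>k. level_width k (bst_of w) = antidiag A B k"
    using assms(1) by (simp_all add: butterfly_shape_def)
  have sh': "longest (<) ?w' = A" "longest (>) ?w' = B"
    using sh by (simp_all add: longest_map)
  have less: "\<forall>x\<in>set w. \<forall>y\<in>set ?w'. x < y"
  proof (intro ballI)
    fix x y assume "x \<in> set w" "y \<in> set ?w'"
    then obtain z where "z \<in> set w" "y = K + z" by auto
    with \<open>x \<in> set w\<close> w have "x \<in> {1..K}" "z \<in> {1..K}" by blast+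
    with \<open>y = K + z\<close> show "x < y" by simp
  qed
  \<comment> \<open>The first form serves \<open>>\<close> and the left graft on
    \<open>?w' @ w\<close>; the other two rule out chains across the halves.\<close>
  then have less': "\<forall>y\<in>set ?w'. \<forall>x\<in>set w. x < y" "\<forall>x\<in>set w. \<forall>y\<in>set ?w'. \<not> x > y"
      "\<forall>y\<in>set ?w'. \<forall>x\<in>set w. \<not> y < x"
    by (fastforce dest: order.asym)+
  have ne: "bst_of w \<noteq> \<langle>\<rangle>" using sh by auto
  have t1: "bst_of (w @ ?w') = graft True (bst_of w) (map_tree ((+) K) (bst_of w))"
    using bst_of_append[of w ?w' True] less bst_of_map[OF mono] by simp
  have t2: "bst_of (?w' @ w) = graft False (map_tree ((+) K) (bst_of w)) (bst_of w)"
    using bst_of_append[of ?w' w False] less' bst_of_map[OF mono] by simp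
  show "butterfly_shape (2 * A) B (w @ ?w')"
    unfolding butterfly_shape_def t1
    using sh sh' longest_append_comparable[OF less] longest_append_incomparable[OF less'(2)]
      spine_graft_other[OF ne, of True]
    by (simp add: spine_graft spine_map_tree level_width_graft level_width_map_tree mult_2
        antidiag_add)
  \<comment> \<open>Now \<open>B\<close> is doubled while \<open>antidiag_add\<close> splits the
    first argument, hence the swap by \<open>antidiag_commute\<close>.\<close>
  show "butterfly_shape A (2 * B) (?w' @ w)"
    unfolding butterfly_shape_def t2
    using sh sh' longest_append_comparable[OF less'(1)] longest_append_incomparable[OF less'(3)]
      spine_graft_other[of "map_tree ((+) K) (bst_of w)" False] ne
    by (simp add: spine_graft spine_map_tree level_width_graft level_width_map_tree mult_2
        antidiag_add antidiag_commute[of A])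
qed

section \<open>One-line words of Kronecker products and the elements of S_2\<close>

lemma set_one_line: "\<pi> permutes {1..k} \<Longrightarrow> set (one_line k \<pi>) = {1..k}"
  by (simp only: one_line_def set_map set_upt atLeastLessThanSuc_atLeastAtMost permutes_image)

text \<open>The outer factor moves whole blocks of length \<open>k\<close>, the inner one acts
  within each block. The offsets are 0 and \<open>k\<close>, in the order given by
  \<open>\<rho>\<close>.\<close>

lemma one_line_kron_perm:
  assumes "\<rho> permutes {1..2}" and "\<pi> permutes {1..k}"
  shows "one_line (2 * k) (kron_perm 2 \<rho> k \<pi>) =
    map ((+) (k * (\<rho> 1 - 1))) (one_line k \<pi>) @ map ((+) (k * (\<rho> 2 - 1))) (one_line k \<pi>)"
  unfolding kron_perm_eq[OF assms]
proof (rule nth_equalityI)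
  fix i assume "i < length (one_line (2 * k) (kron_fun 2 \<rho> k \<pi>))"
  then have i: "i < 2 * k" by (simp add: one_line_def del: upt_Suc)
  show "one_line (2 * k) (kron_fun 2 \<rho> k \<pi>) ! i =
      (map ((+) (k * (\<rho> 1 - 1))) (one_line k \<pi>) @ map ((+) (k * (\<rho> 2 - 1))) (one_line k \<pi>)) ! i"
  proof (cases "i < k")
    case True
    with i show ?thesis by (simp add: one_line_def kron_fun_def nth_append del: upt_Suc)
  next
    case False
    with i have "i div k = 1" "i mod k = i - k"
      by (simp_all add: div_nat_eqI le_mod_geq)
    with i False show ?thesis
      by (simp add: one_line_def kron_fun_def nth_append numeral_2_eq_2 del: upt_Suc)
  qed
qed (simp add: one_line_def del: upt_Suc)

lemma permutes_1_2_cases: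
  assumes "\<rho> permutes {1..2::nat}"
  obtains "\<rho> = id" | "\<rho> = Transposition.transpose 1 2"
proof -
  have "{1..2} = {1, 2::nat}" by auto
  with assms show ?thesis using that by (metis permutes_doubleton_iff)
qed

lemma permutes_1_2_eqI:
  assumes "\<rho> permutes {1..2::nat}" "\<sigma> permutes {1..2}" "\<rho> 1 = \<sigma> 1"
  shows "\<rho> = \<sigma>"
  by (rule permutes_1_2_cases[OF assms(1)]; rule permutes_1_2_cases[OF assms(2)];
      use assms(3) in simp)

lemma transpose_1_2_neq_id: "Transposition.transpose 1 2 \<noteq> (id :: nat \<Rightarrow> nat)"
proof
  assume "Transposition.transpose 1 2 = (id :: nat \<Rightarrow> nat)"
  from fun_cong[OF this, of 1] show False by simp
qed

section \<open>Shape in terms of the number of identity factors\<close>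

definition id_count :: "nat \<Rightarrow> (nat \<Rightarrow> 'a \<Rightarrow> 'a) \<Rightarrow> nat" where
  "id_count n p = card {j\<in>{1..n}. p j = id}"

lemma id_count_Suc:
  "id_count (Suc n) p = (if p (Suc n) = id then Suc (id_count n p) else id_count n p)"
proof -
  have "{j\<in>{1..Suc n}. p j = id} =
      (if p (Suc n) = id then insert (Suc n) {j\<in>{1..n}. p j = id} else {j\<in>{1..n}. p j = id})"
    by (auto simp: le_Suc_eq)
  then show ?thesis by (simp add: id_count_def)
qed

lemma id_count_le: "id_count n p \<le> n"
  by (induction n) (simp_all add: id_count_Suc, simp add: id_count_def)

text \<open>The newest factor is the outermost, so it doubles the word of the earlier product with K
  = 2^n: the identity doubles the first parameter, the transposition the second.\<close>

lemma butterfly_shape_kron_seq: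
  assumes "\<forall>j\<in>{1..n}. p j permutes {1..2}"
  shows "butterfly_shape (2 ^ id_count n p) (2 ^ (n - id_count n p))
    (one_line (2 ^ n) (kron_seq n p))"
  using assms
proof (induction n)
  case 0
  show ?case using butterfly_shape_singleton[of 1] by (simp add: one_line_def id_count_def)
next
  case (Suc n)
  let ?w = "one_line (2 ^ n) (kron_seq n p)"
  have p: "p (Suc n) permutes {1..2}" "kron_seq n p permutes {1..2 ^ n}"
    using Suc.prems kron_seq_permutes[of n p] by simp_all
  have IH: "butterfly_shape (2 ^ id_count n p) (2 ^ (n - id_count n p)) ?w"
    using Suc by simp
  have w: "set ?w \<subseteq> {1..2 ^ n}"
    using set_one_line[OF p(2)] by simp
  note shape = butterfly_shape_double[OF IH w]
  have shift_0: "map ((+) 0) xs = xs" for xs :: "nat list" by (simp add: map_idI)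
  from p(1) show ?case
  proof (cases rule: permutes_1_2_cases)
    case 1
    then show ?thesis using shape(1) one_line_kron_perm[OF p] by (simp add: id_count_Suc shift_0)
  next
    case 2
    moreover from this have "p (Suc n) \<noteq> id" using transpose_1_2_neq_id by simp
    ultimately show ?thesis using shape(2) one_line_kron_perm[OF p] id_count_le[of n p]
      by (simp add: id_count_Suc Suc_diff_le shift_0)
  qed
qed

lemma max_width_eqI:
  assumes "\<And>k. level_width k t \<le> m" "level_width d t = m"
  shows "max_width t = m"
  unfolding max_width_def
  using assms by (intro Max_eqI finite_level_widths) auto

text \<open>Reads the invariant off at A = 2^a and B = 2^(n-a); since powers of 2 are monotone, the
  minimum moves into the exponent.\<close>

lemma kron_seq_widths:
  assumes "\<forall>j\<in>{1..n}. p j permutes {1..2}"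
  defines "\<pi> \<equiv> kron_seq n p" and "a \<equiv> id_count n p"
  shows "LIS (2 ^ n) \<pi> = 2 ^ a" "LDS (2 ^ n) \<pi> = 2 ^ (n - a)"
    and "max_width (perm_bst (2 ^ n) \<pi>) = 2 ^ min a (n - a)"
    and "level_width (2 ^ min a (n - a) - 1) (perm_bst (2 ^ n) \<pi>) = 2 ^ min a (n - a)"
proof -
  have sh: "butterfly_shape (2 ^ a) (2 ^ (n - a)) (one_line (2 ^ n) \<pi>)"
    unfolding \<pi>_def a_def using assms(1) by (rule butterfly_shape_kron_seq)
  then show "LIS (2 ^ n) \<pi> = 2 ^ a" "LDS (2 ^ n) \<pi> = 2 ^ (n - a)"
    by (simp_all add: butterfly_shape_def LIS_def LDS_def longest_def)
  have min: "min (2 ^ a) (2 ^ (n - a)) = (2 ^ min a (n - a) :: nat)"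
    by (simp add: min_def)
  have lw: "level_width k (perm_bst (2 ^ n) \<pi>) = antidiag (2 ^ a) (2 ^ (n - a)) k" for k
    using sh by (simp add: butterfly_shape_def perm_bst_def)
  show top: "level_width (2 ^ min a (n - a) - 1) (perm_bst (2 ^ n) \<pi>) = 2 ^ min a (n - a)"
    using antidiag_min[of "2 ^ a" "2 ^ (n - a)"] by (simp add: lw min)
  show "max_width (perm_bst (2 ^ n) \<pi>) = 2 ^ min a (n - a)"
    using antidiag_le[of "2 ^ a" "2 ^ (n - a)"] by (intro max_width_eqI[OF _ top]) (simp add: lw min)
qed


section \<open>The uniform distribution\<close>

lemma kron_seq_cong: "(\<And>j. j \<in> {1..n} \<Longrightarrow> p j = q j) \<Longrightarrow> kron_seq n p = kron_seq n q"
  by (induction n) simp_all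

text \<open>In k * a + b with b < k, quotient and remainder by \<open>k\<close> recover the outer
  and the inner value, so factors can be peeled off one by one.\<close>

lemma kron_seq_inject:
  assumes "\<forall>j\<in>{1..n}. p j permutes {1..2}" "\<forall>j\<in>{1..n}. q j permutes {1..2}"
    and "kron_seq n p = kron_seq n q" "j \<in> {1..n}"
  shows "p j = q j"
  using assms
proof (induction n)
  case (Suc n)
  let ?k = "2 ^ n :: nat"
  have p: "p (Suc n) permutes {1..2}" "kron_seq n p permutes {1..?k}"
    using Suc.prems kron_seq_permutes[of n p] by simp_all
  have q: "q (Suc n) permutes {1..2}" "kron_seq n q permutes {1..?k}"
    using Suc.prems kron_seq_permutes[of n q] by simp_all
  \<comment> \<open>The first block suffices: it shows all values of the inner product and the outer
    value at 1, which determines an element of S_2.\<close>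
  have *: "p (Suc n) (Suc 0) = q (Suc n) (Suc 0) \<and> kron_seq n p (Suc i) = kron_seq n q (Suc i)"
    if i: "i < ?k" for i
  proof -
    have i2: "i < 2 * ?k" using i by simp
    obtain a b where ab: "p (Suc n) (Suc 0) = Suc a" "kron_seq n p (Suc i) = Suc b" "b < ?k"
        "kron_fun 2 (p (Suc n)) ?k (kron_seq n p) (Suc i) = Suc (?k * a + b)"
      using kron_fun_Suc[OF p i2] i by (metis div_less mod_less)
    obtain c d where cd: "q (Suc n) (Suc 0) = Suc c" "kron_seq n q (Suc i) = Suc d" "d < ?k"
        "kron_fun 2 (q (Suc n)) ?k (kron_seq n q) (Suc i) = Suc (?k * c + d)"
      using kron_fun_Suc[OF q i2] i by (metis div_less mod_less)
    have eq: "?k * a + b = ?k * c + d"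
      using Suc.prems(3) ab(4) cd(4) kron_perm_eq[OF p] kron_perm_eq[OF q] by simp
    have "(?k * a + b) div ?k = (?k * c + d) div ?k" "(?k * a + b) mod ?k = (?k * c + d) mod ?k"
      using eq by simp_all
    then have "a = c" "b = d" using ab(3) cd(3) by simp_all
    then show ?thesis using ab cd by simp
  qed
  have "kron_seq n p x = kron_seq n q x" for x
  proof (cases "x \<in> {1..?k}")
    case True
    then show ?thesis using * by (cases x) auto
  next
    case False
    then show ?thesis using p(2) q(2) by (simp add: permutes_not_in)
  qed
  then have "kron_seq n p = kron_seq n q" by blast
  moreover have "p (Suc n) = q (Suc n)"
    using p(1) q(1) *[of 0] by (intro permutes_1_2_eqI) simp_all
  ultimately show ?case using Suc by (cases "j = Suc n") auto
qed simp

text \<open>Encodes a product by the set of its identity positions, turning a uniform group element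
  into a uniform subset.\<close>

definition butterfly_of :: "nat \<Rightarrow> nat set \<Rightarrow> nat \<Rightarrow> nat" where
  "butterfly_of n S = kron_seq n (\<lambda>j. if j \<in> S then id else Transposition.transpose 1 2)"

lemma if_transpose_permutes: "(if P then id else Transposition.transpose 1 2) permutes {1..2::nat}"
  using permutes_swap_id[of 1 "{1..2::nat}" 2] by (simp add: permutes_id)

lemma bij_betw_butterfly_of: "bij_betw (butterfly_of n) (Pow {1..n}) (simple_butterfly n)"
proof (rule bij_betw_imageI)
  show "inj_on (butterfly_of n) (Pow {1..n})"
  proof (rule inj_onI)
    fix S T assume ST: "S \<in> Pow {1..n}" "T \<in> Pow {1..n}" "butterfly_of n S = butterfly_of n T"
    have "j \<in> S \<longleftrightarrow> j \<in> T" if "j \<in> {1..n}" for j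
    proof -
      have "(if j \<in> S then id else Transposition.transpose 1 2) =
          (if j \<in> T then id else Transposition.transpose 1 (2::nat))"
        using ST(3) that unfolding butterfly_of_def
        by (intro kron_seq_inject[where n = n and p = "\<lambda>j. if j \<in> S then id else _"
              and q = "\<lambda>j. if j \<in> T then id else _"] ballI if_transpose_permutes)
      then show ?thesis using transpose_1_2_neq_id by (metis (full_types))
    qed
    with ST(1,2) show "S = T" by blast
  qed
  show "butterfly_of n ` Pow {1..n} = simple_butterfly n"
  proof (rule antisym; rule subsetI)
    fix \<pi> assume "\<pi> \<in> butterfly_of n ` Pow {1..n}"
    then show "\<pi> \<in> simple_butterfly n"
      unfolding butterfly_of_def simple_butterfly_def using if_transpose_permutes by blast
  next
    fix \<pi> assume "\<pi> \<in> simple_butterfly n"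
    then obtain p where p: "\<pi> = kron_seq n p" "\<forall>j\<in>{1..n}. p j permutes {1..2}"
      unfolding simple_butterfly_def by blast
    \<comment> \<open>Every factor other than the identity is the transposition, so the identity
      positions determine the product.\<close>
    have "\<pi> = butterfly_of n {j\<in>{1..n}. p j = id}"
      unfolding p(1) butterfly_of_def
    proof (rule kron_seq_cong)
      fix j assume "j \<in> {1..n}"
      with p(2) have "p j permutes {1..2}" by blast
      then show "p j = (if j \<in> {j\<in>{1..n}. p j = id} then id else Transposition.transpose 1 2)"
        using \<open>j \<in> {1..n}\<close> by (cases rule: permutes_1_2_cases) auto
    qed
    then show "\<pi> \<in> butterfly_of n ` Pow {1..n}" by blast
  qed
qed

section \<open>Law of the maximal width\<close>

lemma max_width_butterfly_of:
  assumes "S \<subseteq> {1..n}"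
  shows "max_width (perm_bst (2 ^ n) (butterfly_of n S)) = 2 ^ min (card S) (n - card S)"
proof -
  let ?p = "\<lambda>j. if j \<in> S then id else Transposition.transpose 1 (2::nat)"
  have "?p j = id \<longleftrightarrow> j \<in> S" for j using transpose_1_2_neq_id by simp
  then have "{j\<in>{1..n}. ?p j = id} = S" using assms by blast
  then have "id_count n ?p = card S" by (simp only: id_count_def)
  moreover have "\<forall>j\<in>{1..n}. ?p j permutes {1..2}" using if_transpose_permutes by blast
  ultimately show ?thesis using kron_seq_widths(3)[of n ?p] by (simp only: butterfly_of_def)
qed

text \<open>Of the 2^|A| equally likely subsets, |A| choose k have size k, and (1/2)^k (1/2)^(|A|-k)
  = 2^(-|A|).\<close>

lemma map_pmf_card_Pow:
  assumes "finite A"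
  shows "map_pmf card (pmf_of_set (Pow A)) = binomial_pmf (card A) (1/2)"
proof (rule pmf_eqI)
  fix k
  have "pmf (map_pmf card (pmf_of_set (Pow A))) k = real (card (Pow A \<inter> card -` {k})) / real (card (Pow A))"
    using assms by (subst pmf_map, subst measure_pmf_of_set) auto
  also have "Pow A \<inter> card -` {k} = {B. B \<subseteq> A \<and> card B = k}" by auto
  also have "real (card \<dots>) / real (card (Pow A)) = real (card A choose k) / 2 ^ card A"
    using assms by (simp add: n_subsets card_Pow)
  also have "\<dots> = pmf (binomial_pmf (card A) (1/2)) k"
  proof (cases "k \<le> card A")
    case True
    then have "(1/2) ^ k * (1/2) ^ (card A - k) = (1/2 :: real) ^ card A"
      by (simp flip: power_add)
    then show ?thesis by (simp add: power_divide mult.assoc)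
  qed (simp add: binomial_eq_0)
  finally show "pmf (map_pmf card (pmf_of_set (Pow A))) k = pmf (binomial_pmf (card A) (1/2)) k" .
qed

theorem mainTheorem4:
  fixes n N :: nat
  assumes "n \<ge> 1" and "N = 2 ^ n"
  shows
    "(\<forall>\<pi>\<in>simple_butterfly n.
        max_width (perm_bst N \<pi>) =
          level_width (min (LIS N \<pi>) (LDS N \<pi>) - 1) (perm_bst N \<pi>) \<and>
        max_width (perm_bst N \<pi>) = min (LIS N \<pi>) (LDS N \<pi>)) \<and>
     map_pmf (\<lambda>\<pi>. max_width (perm_bst N \<pi>)) (pmf_of_set (simple_butterfly n)) =
       map_pmf (\<lambda>x. 2 ^ min x (n - x)) (binomial_pmf n (1/2)) \<and>
     (\<forall>\<pi>\<in>simple_butterfly n.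
        max_width (perm_bst N \<pi>) * max (LIS N \<pi>) (LDS N \<pi>) = N)"
proof (intro conjI)
  have *: "max_width (perm_bst N \<pi>) =
          level_width (min (LIS N \<pi>) (LDS N \<pi>) - 1) (perm_bst N \<pi>) \<and>
        max_width (perm_bst N \<pi>) = min (LIS N \<pi>) (LDS N \<pi>) \<and>
        max_width (perm_bst N \<pi>) * max (LIS N \<pi>) (LDS N \<pi>) = N"
    if \<pi>: "\<pi> \<in> simple_butterfly n" for \<pi>
  proof -
    obtain p where p: "\<pi> = kron_seq n p" "\<forall>j\<in>{1..n}. p j permutes {1..2}"
      using \<pi> unfolding simple_butterfly_def by blast
    define a where "a = id_count n p"
    have a: "a \<le> n" by (simp add: a_def id_count_le)
    note widths = kron_seq_widths[OF p(2), folded a_def p(1) assms(2)]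
    have min: "min (2 ^ a) (2 ^ (n - a)) = (2 ^ min a (n - a) :: nat)"
      and max: "max (2 ^ a) (2 ^ (n - a)) = (2 ^ max a (n - a) :: nat)"
      by (simp_all add: min_def max_def)
    \<comment> \<open>Minimum and maximum of two numbers add up to their sum, so the exponents of
      width and longest monotone subsequence add up to n.\<close>
    have "min a (n - a) + max a (n - a) = n" using a by simp
    then have "2 ^ min a (n - a) * 2 ^ max a (n - a) = N"
      using assms(2) by (simp flip: power_add)
    then show ?thesis by (simp only: widths min max simp_thms)
  qed
  then show "\<forall>\<pi>\<in>simple_butterfly n.
        max_width (perm_bst N \<pi>) =
          level_width (min (LIS N \<pi>) (LDS N \<pi>) - 1) (perm_bst N \<pi>) \<and>
        max_width (perm_bst N \<pi>) = min (LIS N \<pi>) (LDS N \<pi>)"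
    and "\<forall>\<pi>\<in>simple_butterfly n. max_width (perm_bst N \<pi>) * max (LIS N \<pi>) (LDS N \<pi>) = N"
    by blast+
  \<comment> \<open>Transport to uniform subsets, where the width depends on the cardinality
    alone.\<close>
  have "pmf_of_set (simple_butterfly n) = map_pmf (butterfly_of n) (pmf_of_set (Pow {1..n}))"
    by (rule map_pmf_of_set_bij_betw[OF bij_betw_butterfly_of, symmetric]) auto
  then have "map_pmf (\<lambda>\<pi>. max_width (perm_bst N \<pi>)) (pmf_of_set (simple_butterfly n)) =
      map_pmf (\<lambda>S. max_width (perm_bst N (butterfly_of n S))) (pmf_of_set (Pow {1..n}))"
    by (simp add: pmf.map_comp o_def)
  also have "\<dots> = map_pmf (\<lambda>S. 2 ^ min (card S) (n - card S)) (pmf_of_set (Pow {1..n}))"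
  proof (rule map_pmf_cong[OF refl])
    fix S assume "S \<in> set_pmf (pmf_of_set (Pow {1..n}))"
    then have "S \<subseteq> {1..n}" by (subst (asm) set_pmf_of_set) auto
    then show "max_width (perm_bst N (butterfly_of n S)) = 2 ^ min (card S) (n - card S)"
      by (simp only: assms(2) max_width_butterfly_of)
  qed
  also have "\<dots> = map_pmf (\<lambda>x. 2 ^ min x (n - x)) (map_pmf card (pmf_of_set (Pow {1..n})))"
    by (simp add: pmf.map_comp o_def)
  also have "map_pmf card (pmf_of_set (Pow {1..n})) = binomial_pmf n (1/2)"
    using map_pmf_card_Pow[of "{1..n}"] by simp
  finally show "map_pmf (\<lambda>\<pi>. max_width (perm_bst N \<pi>)) (pmf_of_set (simple_butterfly n)) =
       map_pmf (\<lambda>x. 2 ^ min x (n - x)) (binomial_pmf n (1/2))" .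
qed

end
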